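(* Let $A_0\in M_n^h(\mathbb{C})$ and, for $x\in\mathbb{R}^n$, let $A(x)=A_0+\mathrm{Diag}(x)$. Fix $x\in\mathbb{R}^n$ and let $S_1\subset\mathbb{C}^n$ be the eigenspace of $A(x)$ corresponding to its maximum eigenvalue $\lambda_1(A(x))$. Then $$\partial(\lambda_1\circ A)(x)=\mathrm{Diag}\big(\partial\lambda_1(A(x))\big)=m_{S_1},$$ where $\partial(\lambda_1\circ A)(x)\subset\mathbb{R}^n$ is the subdifferential at $x$ of the convex function $y\mapsto\lambda_1(A(y))$ on $\mathbb{R}^n$, and $\partial\lambda_1(A(x))\subset M_n^h(\mathbb{C})$ is the subdifferential of $\lambda_1:M_n^h(\mathbb{C})\to\mathbb{R}$ at the matrix $A(x)$.
   Context: $M_n^h(\mathbb{C})$ is the real vector space of Hermitian $n\times n$ complex matrices. For $x\in\mathbb{R}^n$, $\mathrm{Diag}(x)$ is the diagonal matrix with diagonal $x$; for a matrix $M$, $\mathrm{Diag}(M)$ is its main diagonal, identified with a vector (and $\mathrm{Diag}$ of a set of matrices is the set of diagonals). $\lambda_1(M)$ is the largest eigenvalue of the Hermitian matrix $M$; $\lambda_1$ is convex. For a convex function $f:\mathcal{X}\to\mathbb{R}$ on a Banach space, $\partial f(x)=\{v\in\mathcal{X}^*: f(y)-f(x)\ge \mathrm{Re}\,v(y-x)\ \forall y\in\mathcal{X}\}$; the dual of $M_n^h(\mathbb{C})$ is identified with $M_n^h(\mathbb{C})$ via $\langle V,Y\rangle=\mathrm{tr}(VY)$, and the dual of $\mathbb{R}^n$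 with $\mathbb{R}^n$ via the usual inner product. For a subspace $S\subset\mathbb{C}^n$, the moment of $S$ is $m_S=\mathrm{co}\{|v|^2: v\in S,\ \|v\|=1\}\subset\mathbb{R}^n$, where $\mathrm{co}$ is the convex hull and $|v|^2=(|v_1|^2,\dots,|v_n|^2)$ (coordinates in the standard basis). *)

theory Defs
  imports "HOL-Analysis.Analysis"
begin

definition adjoint_mat :: "complex^'n^'n \<Rightarrow> complex^'n^'n" where
  "adjoint_mat M = (\<chi> i j. cnj (M $ j $ i))"

definition hermitian_mats :: "(complex^'n^'n) set" where
  "hermitian_mats = {M. adjoint_mat M = M}"

definition Diag_mat :: "real^'n \<Rightarrow> complex^'n^'n" where
  "Diag_mat x = (\<chi> i j. if i = j then complex_of_real (x $ i) else 0)"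

(* The real part only serves to land in real^'n: this is applied to Hermitian matrices,
   whose diagonal entries are real. *)
definition Diag_vec :: "complex^'n^'n \<Rightarrow> real^'n" where
  "Diag_vec M = (\<chi> i. Re (M $ i $ i))"

definition eigenspace :: "complex^'n^'n \<Rightarrow> complex \<Rightarrow> (complex^'n) set" where
  "eigenspace M \<mu> = {v. M *v v = \<mu> *s v}"

definition eigenvalue :: "complex^'n^'n \<Rightarrow> complex \<Rightarrow> bool" where
  "eigenvalue M \<mu> \<longleftrightarrow> (\<exists>v. v \<noteq> 0 \<and> M *v v = \<mu> *s v)"

(* Meaningful for Hermitian M only: then every eigenvalue is real, and the set below is
   finite and nonempty. *)
definition lambda1 :: "complex^'n^'n \<Rightarrow> real" where
  "lambda1 M = Max {r. eigenvalue M (complex_of_real r)}"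

(* Subdifferential of f : X \<rightarrow> \<real> at x, where X is a finite-dimensional real space given as a
   subspace of the ambient type, and pairing v represents the element of the dual of X that
   is identified with v \<in> X. *)
definition subdifferential ::
    "'a::real_normed_vector set \<Rightarrow> ('a \<Rightarrow> 'a \<Rightarrow> real) \<Rightarrow> ('a \<Rightarrow> real) \<Rightarrow> 'a \<Rightarrow> 'a set" where
  "subdifferential X pairing f x = {v \<in> X. \<forall>y\<in>X. f y - f x \<ge> pairing v (y - x)}"

(* tr(VY) is real for Hermitian V and Y. *)
definition trace_pairing :: "complex^'n^'n \<Rightarrow> complex^'n^'n \<Rightarrow> real" where
  "trace_pairing V Y = Re (trace (V ** Y))"

definition moment :: "(complex^'n) set \<Rightarrow> (real^'n) set" where
  "moment S = convex hull {(\<chi> i. (cmod (v $ i))\<^sup>2) | v. v \<in> S \<and> norm v = 1}"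

lemma subspace_hermitian_mats: "subspace (hermitian_mats :: (complex^'n^'n) set)"
  unfolding subspace_def hermitian_mats_def adjoint_mat_def
  by (auto simp: vec_eq_iff)

lemma trace_pairing_eq_inner:
  assumes "V \<in> hermitian_mats"
  shows "trace_pairing V Y = V \<bullet> Y"
proof -
  have "V $ i $ j = cnj (V $ j $ i)" for i j
    using assms by (simp add: hermitian_mats_def adjoint_mat_def vec_eq_iff)
  then have "Re (V $ i $ j * Y $ j $ i) = V $ j $ i \<bullet> Y $ j $ i" for i j
    by (metis (no_types, lifting) cnj.simps inner_complex_def minus_mult_minus
        mult_minus_left diff_minus_eq_add times_complex.simps(1))
  then show ?thesis
    unfolding trace_pairing_def trace_def matrix_matrix_mult_def inner_vec_def
    by (simp, subst sum.swap) simp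
qed

lemma trace_hermitian_real:
  assumes "V \<in> hermitian_mats" "Y \<in> hermitian_mats"
  shows "trace (V ** Y) = complex_of_real (trace_pairing V Y)"
proof -
  have V: "cnj (V $ i $ j) = V $ j $ i" and Y: "cnj (Y $ i $ j) = Y $ j $ i" for i j
    using assms by (simp_all add: hermitian_mats_def adjoint_mat_def vec_eq_iff)
  have "cnj (trace (V ** Y)) = (\<Sum>i\<in>UNIV. \<Sum>j\<in>UNIV. V $ j $ i * Y $ i $ j)"
    unfolding trace_def matrix_matrix_mult_def by (simp add: V Y)
  also have "\<dots> = trace (V ** Y)"
    unfolding trace_def matrix_matrix_mult_def by (subst sum.swap) simp
  finally show ?thesis
    unfolding trace_pairing_def by (metis Reals_cnj_iff of_real_Re)
qed

(* The trace pairing identifies the Hermitian matrices with their dual. *)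
lemma hermitian_mats_dual:
  fixes \<phi> :: "complex^'n^'n \<Rightarrow> real"
  assumes add: "\<And>Y Z. Y \<in> hermitian_mats \<Longrightarrow> Z \<in> hermitian_mats \<Longrightarrow> \<phi> (Y + Z) = \<phi> Y + \<phi> Z"
    and scale: "\<And>c Y. Y \<in> hermitian_mats \<Longrightarrow> \<phi> (c *\<^sub>R Y) = c * \<phi> Y"
  shows "\<exists>!V. V \<in> hermitian_mats \<and> (\<forall>Y\<in>hermitian_mats. \<phi> Y = trace_pairing V Y)"
proof -
  let ?H = "hermitian_mats :: (complex^'n^'n) set"
  obtain B where B: "B \<subseteq> ?H" "independent B" "?H \<subseteq> span B"
    using maximal_independent_subset by blast
  obtain g where g: "linear g" "\<forall>b\<in>B. g b = \<phi> b"
    using linear_independent_extend[OF B(2)] by blast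
  have "Y \<in> ?H \<and> g Y = \<phi> Y" if "Y \<in> span B" for Y
    using that
  proof (induction rule: span_induct_alt)
    case base
    show ?case
      using scale[OF subspace_0[OF subspace_hermitian_mats], of 0]
        subspace_0[OF subspace_hermitian_mats] linear_0[OF g(1)] by simp
  next
    case (step c b z)
    have cb: "c *\<^sub>R b \<in> ?H"
      using step B(1) subspace_scale[OF subspace_hermitian_mats] by blast
    have "c *\<^sub>R b + z \<in> ?H"
      using cb step subspace_add[OF subspace_hermitian_mats] by blast
    moreover have "g (c *\<^sub>R b + z) = \<phi> (c *\<^sub>R b + z)"
      using step B(1) g add[of "c *\<^sub>R b" z] cb scale[of b c]
      by (auto simp: linear_add linear_scale)
    ultimately show ?case by blast
  qed
  then have g\<phi>: "g Y = \<phi> Y" if "Y \<in> ?H" for Y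
    using that B(3) by blast
  have gin: "g Y = adjoint g 1 \<bullet> Y" for Y
    using adjoint_works[OF g(1), of Y 1] by (simp add: inner_commute)
  obtain V W where VW: "V \<in> span ?H" "\<And>Y. Y \<in> span ?H \<Longrightarrow> orthogonal W Y" "adjoint g 1 = V + W"
    using orthogonal_subspace_decomp_exists[of ?H "adjoint g 1"] by metis
  have V: "V \<in> ?H" using VW(1) subspace_hermitian_mats span_eq_iff by metis
  have rep: "\<phi> Y = trace_pairing V Y" if "Y \<in> ?H" for Y
    using g\<phi>[OF that] gin[of Y] VW(2)[of Y] VW(3) span_base[OF that] trace_pairing_eq_inner[OF V, of Y]
    by (simp add: inner_add_left orthogonal_def)
  show ?thesis
  proof (rule ex1I[of _ V])
    fix U assume U: "U \<in> ?H \<and> (\<forall>Y\<in>?H. \<phi> Y = trace_pairing U Y)"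
    have "U - V \<in> ?H" using U V subspace_diff[OF subspace_hermitian_mats] by blast
    then have "U \<bullet> (U - V) = V \<bullet> (U - V)"
      using U rep V by (metis trace_pairing_eq_inner)
    then have "(U - V) \<bullet> (U - V) = 0" by (simp add: inner_diff_left)
    then show "U = V" by simp
  qed (use V rep in blast)
qed

end

(* By the variational principle, lambda1 M is the maximum of the Rayleigh form v \<bullet> (M *v v) over
   the unit sphere, and the unit maximizers are the unit vectors of the top eigenspace. For such
   a v the rank one matrix v v* is a subgradient of lambda1 with diagonal |v|^2, so the moment is
   contained in the diagonals of subgradients, and these are subgradients of the composition.
   If a subgradient d of the composition were outside the (compact convex) moment, some h would
   separate it; unit top eigenvectors of A (x + t h) satisfy h \<bullet> |v|^2 \<ge> h \<bullet> d, and for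
   t \<rightarrow> 0 they accumulate at a top eigenvector of A x, which contradicts the separation. *)
theory Submission
  imports Defs
begin

text \<open>The inner product is the real one on \<open>complex^'n\<close>, so this is the real part
  of v* M v; for Hermitian \<open>M\<close> that number is real already.\<close>

definition rayleigh :: "complex^'n^'n \<Rightarrow> complex^'n \<Rightarrow> real" where
  "rayleigh M v = v \<bullet> (M *v v)"

definition sqmod_vec :: "complex^'n \<Rightarrow> real^'n" where
  "sqmod_vec v = (\<chi> i. (cmod (v $ i))\<^sup>2)"

definition outer_square :: "complex^'n \<Rightarrow> complex^'n^'n" where
  "outer_square v = (\<chi> i j. v $ i * cnj (v $ j))"

section \<open>Complex matrices as real-linear maps\<close>

lemma of_real_vector_smult: "complex_of_real r *s v = r *\<^sub>R v"
  by (simp add: vec_eq_iff scaleR_conv_of_real[where 'a = complex])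

lemma mem_eigenspace_of_real:
  "v \<in> eigenspace M (complex_of_real r) \<longleftrightarrow> M *v v = r *\<^sub>R v"
  by (simp add: eigenspace_def of_real_vector_smult)

lemma eigenvalue_of_real:
  "eigenvalue M (complex_of_real r) \<longleftrightarrow> (\<exists>v. v \<noteq> 0 \<and> M *v v = r *\<^sub>R v)"
  by (simp add: eigenvalue_def of_real_vector_smult)

lemma linear_complex_matrix_vector: "linear ((*v) (M :: complex^'n^'m))"
  by (rule linearI) (simp_all add: vec_eq_iff matrix_vector_mult_def scaleR_sum_right
      distrib_left sum.distrib)

lemma inner_complex_mult_left: "a \<bullet> (m * b) = (cnj m * a) \<bullet> (b :: complex)"
  by (simp add: inner_complex_def algebra_simps)

lemma hermitian_mats_inner:
  assumes "M \<in> hermitian_mats"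
  shows "v \<bullet> (M *v w) = (M *v v) \<bullet> w"
proof -
  have M: "cnj (M $ i $ j) = M $ j $ i" for i j
    using assms by (simp add: hermitian_mats_def adjoint_mat_def vec_eq_iff)
  have "v \<bullet> (M *v w) = (\<Sum>i\<in>UNIV. \<Sum>j\<in>UNIV. (M $ j $ i * v $ i) \<bullet> w $ j)"
    by (simp add: inner_vec_def matrix_vector_mult_def inner_sum_right inner_complex_mult_left M)
  also have "\<dots> = (M *v v) \<bullet> w"
    by (subst sum.swap) (simp add: inner_vec_def matrix_vector_mult_def inner_sum_left)
  finally show ?thesis .
qed

section \<open>The Rayleigh form and the largest eigenvalue\<close>

lemma rayleigh_scaleR: "rayleigh M (c *\<^sub>R v) = c\<^sup>2 * rayleigh M v"
  by (simp add: rayleigh_def linear_scale[OF linear_complex_matrix_vector] power2_eq_square)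

lemma rayleigh_eigenvector: "M *v v = r *\<^sub>R v \<Longrightarrow> norm v = 1 \<Longrightarrow> rayleigh M v = r"
  by (simp add: rayleigh_def norm_eq_1)

lemma continuous_on_rayleigh: "continuous_on S (rayleigh M)"
  unfolding rayleigh_def
  by (intro continuous_on_inner continuous_on_id linear_continuous_on
      linear_linear[THEN iffD2] linear_complex_matrix_vector)

text \<open>Eigenvectors for distinct real eigenvalues are orthogonal, hence independent, so there
  are only finitely many. Finiteness gives meaning to the \<open>Max\<close> in
  \<open>lambda1\<close>.\<close>

lemma finite_real_eigenvalues:
  assumes "M \<in> hermitian_mats"
  shows "finite {r. eigenvalue M (complex_of_real r)}" (is "finite ?R")
proof -
  have "\<forall>r\<in>?R. \<exists>v. v \<noteq> 0 \<and> M *v v = r *\<^sub>R v"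
    by (simp add: eigenvalue_of_real)
  then obtain f where f: "\<And>r. r \<in> ?R \<Longrightarrow> f r \<noteq> 0 \<and> M *v f r = r *\<^sub>R f r"
    by metis
  have orth: "f r \<bullet> f s = 0" if "r \<in> ?R" "s \<in> ?R" "r \<noteq> s" for r s
    using hermitian_mats_inner[OF assms, of "f r" "f s"] f[OF that(1)] f[OF that(2)] that(3)
    by simp
  have inj: "inj_on f ?R"
    by (rule inj_onI) (metis orth f inner_eq_zero_iff)
  have "pairwise orthogonal (f ` ?R)"
    using orth unfolding pairwise_def orthogonal_def by (metis imageE)
  moreover have "0 \<notin> f ` ?R"
    using f by (auto simp: image_iff)
  ultimately have "finite (f ` ?R)"
    by (intro independent_imp_finite pairwise_orthogonal_independent)
  then show ?thesis
    using inj by (rule finite_imageD)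
qed

text \<open>The form \<open>g\<close> below, m |v|^2 minus the Rayleigh form, is nonnegative and
  vanishes at \<open>u\<close>. So its derivative at \<open>u\<close> is zero, and along the
  residual \<open>w\<close> that derivative is 2 |w|^2.\<close>

lemma rayleigh_maximizer_eigenvector:
  assumes M: "M \<in> hermitian_mats" and u: "norm u = 1"
    and max: "\<And>v. norm v = 1 \<Longrightarrow> rayleigh M v \<le> rayleigh M u"
  shows "M *v u = rayleigh M u *\<^sub>R u"
proof -
  define m where "m = rayleigh M u"
  define g where "g v = m * (norm v)\<^sup>2 - rayleigh M v" for v
  have g_nonneg: "g v \<ge> 0" for v
  proof (cases "v = 0")
    case True
    then show ?thesis by (simp add: g_def rayleigh_def)
  next
    case False
    then have "rayleigh M v = (norm v)\<^sup>2 * rayleigh M (sgn v)"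
      using rayleigh_scaleR[of M "norm v" "sgn v"] by (simp add: sgn_div_norm)
    also have "\<dots> \<le> (norm v)\<^sup>2 * m"
      using max[of "sgn v"] False by (simp add: m_def norm_sgn mult_left_mono)
    finally show ?thesis by (simp add: g_def mult.commute)
  qed
  define w where "w = m *\<^sub>R u - M *v u"
  have expand: "g (u + t *\<^sub>R w) = 2 * t * (w \<bullet> w) + t\<^sup>2 * g w" for t
  proof -
    have "u \<bullet> (M *v w) = (M *v u) \<bullet> w" "w \<bullet> (M *v u) = (M *v u) \<bullet> w" "w \<bullet> u = u \<bullet> w"
      by (simp_all add: hermitian_mats_inner[OF M, of u w] inner_commute)
    then have "g (u + t *\<^sub>R w) = g u + 2 * t * (m * (u \<bullet> w) - (M *v u) \<bullet> w) + t\<^sup>2 * g w"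
      unfolding g_def rayleigh_def power2_norm_eq_inner
      by (simp add: linear_add[OF linear_complex_matrix_vector]
          linear_scale[OF linear_complex_matrix_vector] inner_add_left inner_add_right)
        (simp add: algebra_simps power2_eq_square)
    moreover have "g u = 0"
      using u by (simp add: g_def m_def)
    moreover have "w \<bullet> w = m * (u \<bullet> w) - (M *v u) \<bullet> w"
      by (subst (1) w_def) (simp add: inner_diff_left)
    ultimately show ?thesis by simp
  qed
  have "w \<bullet> w = 0"
  proof (rule ccontr)
    assume "w \<bullet> w \<noteq> 0"
    then have pos: "w \<bullet> w > 0" by simp
    \<comment> \<open>This step length lets the linear term win: at t = -s the expansion equals -s
      (w \<bullet> w + s). The added 1 keeps the denominator positive even if \<open>g w\<close> is
      0.\<close>
    define s where "s = (w \<bullet> w) / (g w + 1)"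
    have gw: "g w + 1 > 0" using g_nonneg[of w] by simp
    have s: "s > 0" "s * (g w + 1) = w \<bullet> w" using pos gw by (simp_all add: s_def)
    have "0 \<le> 2 * (- s) * (w \<bullet> w) + (- s)\<^sup>2 * g w"
      using g_nonneg[of "u + (- s) *\<^sub>R w"] expand[of "- s"] by simp
    also have "\<dots> = - s * (w \<bullet> w + s)"
      by (simp flip: s(2) add: power2_eq_square algebra_simps)
    also have "\<dots> < 0" using s(1) pos by (simp add: mult_pos_pos add_pos_pos)
    finally show False by simp
  qed
  then show ?thesis by (simp add: w_def m_def)
qed

text \<open>A maximizer exists by compactness of the sphere and is an eigenvector; conversely, every
  real eigenvalue is the Rayleigh value of a normalized eigenvector.\<close>

lemma
  fixes M :: "complex^'n^'n"
  assumes M: "M \<in> hermitian_mats"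
  shows lambda1_attained: "\<exists>u. norm u = 1 \<and> rayleigh M u = lambda1 M"
    and rayleigh_le_lambda1: "norm v = 1 \<Longrightarrow> rayleigh M v \<le> lambda1 M"
proof -
  have "sphere (0 :: complex^'n) 1 \<noteq> {}"
    using vector_choose_size[of 1] by (metis dist_0_norm emptyE mem_sphere zero_le_one)
  then obtain u where u: "u \<in> sphere 0 1" "\<forall>v\<in>sphere 0 1. rayleigh M v \<le> rayleigh M u"
    using continuous_attains_sup[OF compact_sphere _ continuous_on_rayleigh] by blast
  then have u1: "norm u = 1" and umax: "\<And>v. norm v = 1 \<Longrightarrow> rayleigh M v \<le> rayleigh M u"
    by auto
  have eig: "M *v u = rayleigh M u *\<^sub>R u"
    using rayleigh_maximizer_eigenvector[OF M u1 umax] .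
  have "lambda1 M = rayleigh M u"
    unfolding lambda1_def
  proof (rule Max_eqI)
    show "finite {r. eigenvalue M (complex_of_real r)}"
      by (rule finite_real_eigenvalues[OF M])
    show "rayleigh M u \<in> {r. eigenvalue M (complex_of_real r)}"
      using eig u1 by (auto simp: eigenvalue_of_real intro!: exI[of _ u])
  next
    fix r assume "r \<in> {r. eigenvalue M (complex_of_real r)}"
    then obtain v where v: "v \<noteq> 0" "M *v v = r *\<^sub>R v"
      by (auto simp: eigenvalue_of_real)
    then have "M *v sgn v = r *\<^sub>R sgn v"
      by (simp add: sgn_div_norm linear_scale[OF linear_complex_matrix_vector])
    then have "r = rayleigh M (sgn v)"
      using v(1) by (intro rayleigh_eigenvector[symmetric]) (simp_all add: norm_sgn)
    also have "\<dots> \<le> rayleigh M u"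
      using v(1) by (intro umax) (simp add: norm_sgn)
    finally show "r \<le> rayleigh M u" .
  qed
  then show "\<exists>u. norm u = 1 \<and> rayleigh M u = lambda1 M"
    and "norm v = 1 \<Longrightarrow> rayleigh M v \<le> lambda1 M"
    using u1 umax by auto
qed

text \<open>The inequality suffices as a criterion because the reverse one always holds; in this
  form it survives limits.\<close>

lemma unit_top_eigenvector_iff:
  assumes "M \<in> hermitian_mats" "norm v = 1"
  shows "v \<in> eigenspace M (complex_of_real (lambda1 M)) \<longleftrightarrow> rayleigh M v \<ge> lambda1 M"
  unfolding mem_eigenspace_of_real
  using rayleigh_maximizer_eigenvector[OF assms] rayleigh_le_lambda1[OF assms(1)]
    rayleigh_eigenvector[OF _ assms(2)] assms(2)
  by (metis order_antisym order_refl)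

section \<open>Rank one matrices and diagonals\<close>

lemma outer_square_hermitian: "outer_square v \<in> hermitian_mats"
  by (simp add: hermitian_mats_def adjoint_mat_def outer_square_def vec_eq_iff)

text \<open>The real part of tr (v v* Y) = v* Y v: for fixed \<open>v\<close> the Rayleigh form is a
  linear functional of the matrix.\<close>

lemma outer_square_inner: "outer_square v \<bullet> Y = rayleigh Y v"
proof -
  have "(v $ i * cnj (v $ j)) \<bullet> Y $ i $ j = v $ i \<bullet> (Y $ i $ j * v $ j)" for i j
    by (simp add: inner_complex_def algebra_simps)
  then show ?thesis
    by (simp add: outer_square_def rayleigh_def inner_vec_def matrix_vector_mult_def
        inner_sum_right)
qed

lemma Diag_vec_outer_square: "Diag_vec (outer_square v) = sqmod_vec v"
  by (simp add: Diag_vec_def outer_square_def sqmod_vec_def vec_eq_iff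
      complex_mult_cnj cmod_power2)

lemma linear_Diag_vec: "linear Diag_vec"
  by (rule linearI) (simp_all add: Diag_vec_def vec_eq_iff)

lemma Diag_mat_hermitian: "Diag_mat h \<in> hermitian_mats"
  by (auto simp: hermitian_mats_def adjoint_mat_def Diag_mat_def vec_eq_iff)

lemma linear_Diag_mat: "linear Diag_mat"
  by (rule linearI) (simp_all add: Diag_mat_def vec_eq_iff scaleR_conv_of_real[where 'a = complex])

text \<open>\<open>Diag_vec\<close> is the adjoint of \<open>Diag_mat\<close>; this carries
  subgradients of \<open>lambda1\<close> to subgradients of the composition with
  \<open>A\<close>.\<close>

lemma inner_Diag_mat: "V \<bullet> Diag_mat h = Diag_vec V \<bullet> h"
proof -
  have "V $ i $ j \<bullet> Diag_mat h $ i $ j = (if i = j then Re (V $ i $ i) * h $ i else 0)" for i j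
    by (simp add: Diag_mat_def inner_complex_def)
  then show ?thesis
    by (simp add: inner_vec_def Diag_vec_def)
qed

lemma rayleigh_add_Diag_mat:
  "rayleigh (M + Diag_mat h) v = rayleigh M v + sqmod_vec v \<bullet> h"
  by (simp flip: outer_square_inner add: inner_add_right inner_Diag_mat Diag_vec_outer_square)

section \<open>Compactness of the moment\<close>

lemma continuous_on_sqmod_vec: "continuous_on S sqmod_vec"
  unfolding sqmod_vec_def by (intro continuous_intros)

lemma moment_eq: "moment S = convex hull (sqmod_vec ` (S \<inter> sphere 0 1))"
  unfolding moment_def sqmod_vec_def by (intro arg_cong[where f = "(hull) convex"]) auto

lemma closed_eigenspace: "closed (eigenspace M (complex_of_real r))"
proof -
  have "eigenspace M (complex_of_real r) = {v. M *v v = r *\<^sub>R v}"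
    by (auto simp: mem_eigenspace_of_real)
  moreover have "closed {v. M *v v = r *\<^sub>R v}"
    by (intro closed_Collect_eq continuous_intros linear_continuous_on
        linear_linear[THEN iffD2] linear_complex_matrix_vector)
  ultimately show ?thesis by simp
qed

lemma compact_moment_eigenspace: "compact (moment (eigenspace M (complex_of_real r)))"
  unfolding moment_eq
  by (intro compact_convex_hull compact_continuous_image continuous_on_sqmod_vec
      closed_Int_compact closed_eigenspace compact_sphere)

section \<open>Subgradients built from top eigenvectors\<close>

text \<open>The subgradient inequality is affine in the subgradient. Convexity extends the inclusion
  from the vectors |v|^2 to their hull.\<close>

lemma convex_subdifferential_lambda1:
  "convex (subdifferential hermitian_mats trace_pairing lambda1 M)"
proof (rule convexI)
  fix V W and a b :: real
  let ?D = "subdifferential hermitian_mats trace_pairing lambda1 M"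
  assume V: "V \<in> ?D" and W: "W \<in> ?D" and ab: "0 \<le> a" "0 \<le> b" "a + b = 1"
  have H: "V \<in> hermitian_mats" "W \<in> hermitian_mats" "a *\<^sub>R V + b *\<^sub>R W \<in> hermitian_mats"
    using V W subspace_hermitian_mats
    by (auto simp: subdifferential_def intro: subspace_add subspace_scale)
  have "trace_pairing (a *\<^sub>R V + b *\<^sub>R W) (Y - M) \<le> lambda1 Y - lambda1 M"
    if "Y \<in> hermitian_mats" for Y
  proof -
    have "trace_pairing V (Y - M) \<le> lambda1 Y - lambda1 M"
      "trace_pairing W (Y - M) \<le> lambda1 Y - lambda1 M"
      using V W that by (auto simp: subdifferential_def)
    then show ?thesis
      using convex_bound_le[OF _ _ ab] H
      by (simp add: trace_pairing_eq_inner inner_add_left)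
  qed
  then show "a *\<^sub>R V + b *\<^sub>R W \<in> ?D"
    using H by (simp add: subdifferential_def)
qed

text \<open>The vector \<open>v\<close> attains \<open>lambda1 M\<close> but is merely a competitor
  for \<open>lambda1 Y\<close>, so the increment of \<open>lambda1\<close> is at least that of the
  Rayleigh form at \<open>v\<close>, which is the pairing with \<open>Y - M\<close>.\<close>

lemma outer_square_subgradient:
  assumes M: "M \<in> hermitian_mats" and v: "norm v = 1"
    and eig: "v \<in> eigenspace M (complex_of_real (lambda1 M))"
  shows "outer_square v \<in> subdifferential hermitian_mats trace_pairing lambda1 M"
proof -
  have "rayleigh M v \<ge> lambda1 M"
    using unit_top_eigenvector_iff[OF M v] eig by simp
  then have "trace_pairing (outer_square v) (Y - M) \<le> lambda1 Y - lambda1 M"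
    if "Y \<in> hermitian_mats" for Y
    using rayleigh_le_lambda1[OF that v]
    by (simp add: trace_pairing_eq_inner outer_square_hermitian inner_diff_right outer_square_inner)
  then show ?thesis
    by (simp add: subdifferential_def outer_square_hermitian)
qed

lemma moment_subset_Diag_subdifferential:
  assumes "M \<in> hermitian_mats"
  shows "moment (eigenspace M (complex_of_real (lambda1 M)))
    \<subseteq> Diag_vec ` subdifferential hermitian_mats trace_pairing lambda1 M"
  unfolding moment_eq
proof (rule hull_minimal)
  show "convex (Diag_vec ` subdifferential hermitian_mats trace_pairing lambda1 M)"
    by (intro convex_linear_image linear_Diag_vec convex_subdifferential_lambda1)
next
  show "sqmod_vec ` (eigenspace M (complex_of_real (lambda1 M)) \<inter> sphere 0 1)
      \<subseteq> Diag_vec ` subdifferential hermitian_mats trace_pairing lambda1 M"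
    using outer_square_subgradient[OF assms] by (auto simp flip: Diag_vec_outer_square)
qed

section \<open>Separation and limit argument\<close>

lemma subgradient_diagonal_subset_moment:
  fixes M :: "complex^'n^'n"
  assumes M: "M \<in> hermitian_mats"
    and d: "\<And>h. lambda1 (M + Diag_mat h) - lambda1 M \<ge> d \<bullet> h"
  shows "d \<in> moment (eigenspace M (complex_of_real (lambda1 M)))" (is "d \<in> ?m")
proof (rule ccontr)
  assume "d \<notin> ?m"
  moreover have "convex ?m" "closed ?m"
    using compact_moment_eigenspace by (auto simp: moment_def intro: compact_imp_closed)
  ultimately obtain a b where ab: "a \<bullet> d < b" "\<forall>z\<in>?m. b < a \<bullet> z"
    using separating_hyperplane_closed_point by blast
  \<comment> \<open>The sign change turns the separating functional into a perturbation direction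
    along which \<open>d\<close> exceeds the whole moment.\<close>
  define h where "h = - a"
  have sep: "h \<bullet> z < h \<bullet> d" if "z \<in> ?m" for z
    using ab that by (force simp: h_def)
  define t where "t n = inverse (real (Suc n))" for n
  have t_pos: "t n > 0" for n by (simp add: t_def)
  have t_lim: "t \<longlonglongrightarrow> 0" unfolding t_def by (rule LIMSEQ_inverse_real_of_nat)
  have "\<exists>v. norm v = 1 \<and>
      rayleigh (M + Diag_mat (t n *\<^sub>R h)) v = lambda1 (M + Diag_mat (t n *\<^sub>R h))" for n
    by (intro lambda1_attained subspace_add[OF subspace_hermitian_mats] M Diag_mat_hermitian)
  then obtain u where u: "\<And>n. norm (u n) = 1"
    and "\<And>n. rayleigh (M + Diag_mat (t n *\<^sub>R h)) (u n) = lambda1 (M + Diag_mat (t n *\<^sub>R h))"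
    by metis
  \<comment> \<open>The subgradient inequality at \<open>t n *\<^sub>R h\<close>, with
    \<open>lambda1\<close> of the perturbed matrix expanded at its maximizer
    \<open>u n\<close>.\<close>
  then have key: "rayleigh M (u n) + t n * (sqmod_vec (u n) \<bullet> h) \<ge> lambda1 M + t n * (d \<bullet> h)" for n
    using d[of "t n *\<^sub>R h"] by (simp add: rayleigh_add_Diag_mat algebra_simps)
  have above: "sqmod_vec (u n) \<bullet> h \<ge> d \<bullet> h" for n
  proof -
    have "t n * (sqmod_vec (u n) \<bullet> h) \<ge> t n * (d \<bullet> h)"
      using key[of n] rayleigh_le_lambda1[OF M u[of n]] by linarith
    then show ?thesis using t_pos[of n] by simp
  qed
  have "\<forall>n. u n \<in> sphere 0 1" using u by simp
  then obtain v r where v: "v \<in> sphere 0 1" and r: "strict_mono r" and lim: "(u \<circ> r) \<longlonglongrightarrow> v"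
    using compact_sphere[unfolded compact_def] by metis
  have tr: "(\<lambda>n. t (r n)) \<longlonglongrightarrow> 0"
    using LIMSEQ_subseq_LIMSEQ[OF t_lim r] by (simp add: o_def)
  have ray: "(\<lambda>n. rayleigh M (u (r n))) \<longlonglongrightarrow> rayleigh M v"
    using continuous_on_tendsto_compose[OF continuous_on_rayleigh[of UNIV] lim]
    by (simp add: o_def)
  have sq: "(\<lambda>n. sqmod_vec (u (r n)) \<bullet> h) \<longlonglongrightarrow> sqmod_vec v \<bullet> h"
    using continuous_on_tendsto_compose[OF continuous_on_sqmod_vec[of UNIV] lim]
    by (intro tendsto_inner tendsto_const) (simp add: o_def)
  \<comment> \<open>In the limit of \<open>key\<close> the terms with a factor \<open>t\<close>
    vanish, which makes \<open>v\<close> a maximizer for \<open>M\<close> and hence a top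
    eigenvector.\<close>
  have "(\<lambda>n. rayleigh M (u (r n)) + t (r n) * (sqmod_vec (u (r n)) \<bullet> h))
      \<longlonglongrightarrow> rayleigh M v + 0 * (sqmod_vec v \<bullet> h)"
    by (intro tendsto_intros ray tr sq)
  moreover have "(\<lambda>n. lambda1 M + t (r n) * (d \<bullet> h)) \<longlonglongrightarrow> lambda1 M + 0 * (d \<bullet> h)"
    by (intro tendsto_intros tr)
  ultimately have "rayleigh M v \<ge> lambda1 M"
    using key LIMSEQ_le by fastforce
  then have "sqmod_vec v \<in> ?m"
    using v unit_top_eigenvector_iff[OF M, of v] unfolding moment_eq
    by (intro hull_inc) auto
  moreover have "sqmod_vec v \<bullet> h \<ge> d \<bullet> h"
    using LIMSEQ_le_const[OF sq] above by blast
  ultimately show False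
    using sep[of "sqmod_vec v"] by (simp add: inner_commute)
qed

theorem theorem3:
  fixes A\<^sub>0 :: "complex^'n^'n" and A :: "real^'n \<Rightarrow> complex^'n^'n" and x :: "real^'n"
  assumes "A\<^sub>0 \<in> hermitian_mats"
    and "\<And>y. A y = A\<^sub>0 + Diag_mat y"
  shows "subdifferential UNIV (\<bullet>) (lambda1 \<circ> A) x
           = Diag_vec ` subdifferential hermitian_mats trace_pairing lambda1 (A x)
       \<and> Diag_vec ` subdifferential hermitian_mats trace_pairing lambda1 (A x)
           = moment (eigenspace (A x) (complex_of_real (lambda1 (A x))))"
proof -
  let ?S = "subdifferential UNIV (\<bullet>) (lambda1 \<circ> A) x"
  let ?D = "Diag_vec ` subdifferential hermitian_mats trace_pairing lambda1 (A x)"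
  let ?m = "moment (eigenspace (A x) (complex_of_real (lambda1 (A x))))"
  have herm: "A y \<in> hermitian_mats" for y
    using assms by (simp add: subspace_add[OF subspace_hermitian_mats] Diag_mat_hermitian)
  have shift: "A (x + h) = A x + Diag_mat h" for h
    by (simp add: assms(2) linear_add[OF linear_Diag_mat])
  \<comment> \<open>Three inclusions in a cycle give both equalities.\<close>
  have "?m \<subseteq> ?D"
    by (rule moment_subset_Diag_subdifferential[OF herm])
  moreover have "?D \<subseteq> ?S"
  \<comment> \<open>The inequality is tested only on the matrices \<open>A y\<close>; as
    \<open>A y - A x\<close> is diagonal, the pairing sees only the diagonal of
    \<open>V\<close>.\<close>
  proof (rule image_subsetI)
    fix V assume "V \<in> subdifferential hermitian_mats trace_pairing lambda1 (A x)"
    then have V: "V \<in> hermitian_mats"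
      "\<And>y. lambda1 (A y) - lambda1 (A x) \<ge> trace_pairing V (A y - A x)"
      using herm by (auto simp: subdifferential_def)
    moreover have "A y - A x = Diag_mat (y - x)" for y
      using shift[of "y - x"] by simp
    ultimately show "Diag_vec V \<in> ?S"
      by (simp add: subdifferential_def trace_pairing_eq_inner inner_Diag_mat)
  qed
  moreover have "?S \<subseteq> ?m"
  proof
    fix d assume d: "d \<in> ?S"
    have "lambda1 (A x + Diag_mat h) - lambda1 (A x) \<ge> d \<bullet> h" for h
    proof -
      have "(lambda1 \<circ> A) (x + h) - (lambda1 \<circ> A) x \<ge> d \<bullet> (x + h - x)"
        using d by (simp only: subdifferential_def) blast
      then show ?thesis by (simp add: shift)
    qed
    then show "d \<in> ?m"
      by (rule subgradient_diagonal_subset_moment[OF herm])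
  qed
  ultimately show ?thesis by blast
qed

end
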